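(* Fix $t>0$, $x_0\in\mathbb{R}$, $\theta>0$ and $\sigma>0$. For $\mu\in\mathbb{R}$ let $\gamma_{\mu}$ be the Gaussian probability measure on $\mathbb{R}$ with mean $m_t=x_0e^{-\theta t}+\mu(1-e^{-\theta t})$ and variance $\sigma_t^2=\frac{\sigma^2}{2\theta}\left(1-e^{-2\theta t}\right)$. For $n\in\mathbb{N}$, $n\ge 1$, define $T_n^*:\mathbb{R}^n\to\mathbb{R}$ by $$T_n^*(z_1,\dots,z_n)=\left(\frac{\sum_{k=1}^n z_k}{n}-x_0e^{-\theta t}\right)\Big/\left(1-e^{-\theta t}\right).$$ Then for every $\mu\in\mathbb{R}$, $$\gamma_{\mu}^{\infty}\left(\left\{(z_k)_{k\in\mathbb{N}}\in\mathbb{R}^{\infty}:\ \lim_{n\to\infty}T_n^*(z_1,\dots,z_n)=\mu\right\}\right)=1,$$ that is, $T_n^*$ is a consistent estimator of the parameter $\mu\in\mathbb{R}$, in the sense of convergence almost everywhere, for the family $(\gamma_{\mu}^{\infty})_{\mu\in\mathbb{R}}$.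
   Context: $\mathbb{R}^\infty=\mathbb{R}^{\mathbb{N}}$ is the space of real sequences $(z_k)_{k\in\mathbb{N}}$, $\mathbb{N}=\{1,2,\dots\}$, with its product Borel $\sigma$-algebra; for a Borel probability measure $\gamma$ on $\mathbb{R}$, $\gamma^{\infty}$ denotes the infinite product measure $\gamma\times\gamma\times\cdots$ on $\mathbb{R}^\infty$. Given a family $(\gamma_\vartheta)_{\vartheta\in\Theta}$ of Borel probability measures on $\mathbb{R}$ with $\Theta\subseteq\mathbb{R}$, a sequence of Borel measurable functions $T_n:\mathbb{R}^n\to\mathbb{R}$ is called a consistent estimator of the parameter $\vartheta$ in the sense of convergence almost everywhere for the family $(\gamma_\vartheta^\infty)_{\vartheta\in\Theta}$ if $\gamma_\vartheta^\infty(\{(z_k)_{k\in\mathbb{N}}:\lim_{n\to\infty}T_n(z_1,\dots,z_n)=\vartheta\})=1$ for each $\vartheta\in\Theta$. (The measure $\gamma_{\mu}$ is the law at time $t$ of the Ornstein-Uhlenbeck process $x_t=x_0e^{-\theta t}+\mu(1-e^{-\theta t})+\sigma\int_0^te^{-\theta(t-s)}dW_s$ with $W$ a Wiener process; the claim only uses $\gamma_{\mu}$ as defined in it.) *)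

theory Defs
  imports "HOL-Probability.Probability"
begin

(* A point of R^n is a function in {1..n} \<rightarrow>\<^sub>E UNIV, and a point of R^\<infinity> is a function in
   {1..} \<rightarrow>\<^sub>E UNIV; both are given the product Borel sigma-algebra by PiM.
   The tuple (z_1,...,z_n) of a sequence z is therefore restrict z {1..n}. *)

definition infinite_power :: "real measure \<Rightarrow> (nat \<Rightarrow> real) measure" where
  "infinite_power \<gamma> = PiM {1..} (\<lambda>_. \<gamma>)"

(* The conjunct T n \<in> borel_measurable ... expresses that T n is a Borel function on R^n;
   T 0 is irrelevant. In the last conjunct the measure of a non-measurable set would be 0,
   so value 1 also entails that the event is measurable. *)
definition consistent_estimator ::
  "real set \<Rightarrow> (real \<Rightarrow> real measure) \<Rightarrow> (nat \<Rightarrow> (nat \<Rightarrow> real) \<Rightarrow> real) \<Rightarrow> bool" where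
  "consistent_estimator \<Theta> \<gamma> T \<longleftrightarrow>
     (\<forall>\<theta>\<in>\<Theta>. real_distribution (\<gamma> \<theta>)) \<and>
     (\<forall>n\<ge>1. T n \<in> borel_measurable (PiM {1..n} (\<lambda>_. borel))) \<and>
     (\<forall>\<theta>\<in>\<Theta>. measure (infinite_power (\<gamma> \<theta>))
        {z \<in> space (infinite_power (\<gamma> \<theta>)). (\<lambda>n. T n (restrict z {1..n})) \<longlonglongrightarrow> \<theta>} = 1)"

(* The second parameter is the variance, whereas normal_density takes the standard deviation. *)
definition gaussian_measure :: "real \<Rightarrow> real \<Rightarrow> real measure" where
  "gaussian_measure m v = density lborel (\<lambda>x. ennreal (normal_density m (sqrt v) x))"

definition ou_mean :: "real \<Rightarrow> real \<Rightarrow> real \<Rightarrow> real \<Rightarrow> real" where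
  "ou_mean t x\<^sub>0 \<theta> \<mu> = x\<^sub>0 * exp (- \<theta> * t) + \<mu> * (1 - exp (- \<theta> * t))"

definition ou_variance :: "real \<Rightarrow> real \<Rightarrow> real \<Rightarrow> real" where
  "ou_variance t \<theta> \<sigma> = \<sigma>\<^sup>2 / (2 * \<theta>) * (1 - exp (- 2 * \<theta> * t))"

definition ou_law :: "real \<Rightarrow> real \<Rightarrow> real \<Rightarrow> real \<Rightarrow> real \<Rightarrow> real measure" where
  "ou_law t x\<^sub>0 \<theta> \<sigma> \<mu> = gaussian_measure (ou_mean t x\<^sub>0 \<theta> \<mu>) (ou_variance t \<theta> \<sigma>)"

definition ou_estimator :: "real \<Rightarrow> real \<Rightarrow> real \<Rightarrow> nat \<Rightarrow> (nat \<Rightarrow> real) \<Rightarrow> real" where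
  "ou_estimator t x\<^sub>0 \<theta> n z =
     ((\<Sum>k=1..n. z k) / real n - x\<^sub>0 * exp (- \<theta> * t)) / (1 - exp (- \<theta> * t))"

end

theory Submission
  imports Defs
begin

text \<open>The average of \<open>n\<close> independent normal variables with mean \<open>m\<close> and standard deviation \<open>s\<close> is
  normal with mean \<open>m\<close> and standard deviation \<open>s / sqrt n\<close>, so its fourth central moment is
  \<open>3 s^4 / n^2\<close>. These moments are summable; hence the sum of the fourth powers of the deviations
  is almost surely finite, and its terms tend to zero. The estimator is an affine image of the
  average which sends the mean at time \<open>t\<close> to the drift parameter.\<close>

text \<open>Sum and integral may be exchanged for nonnegative functions, so the series has a finite
  integral and is therefore finite almost everywhere. This takes the place of a Borel-Cantelli
  argument.\<close>

lemma AE_tendsto_zero_if_nn_integral_suminf_finite: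
  fixes g :: "nat \<Rightarrow> 'a \<Rightarrow> real"
  assumes [measurable]: "\<And>n. g n \<in> borel_measurable M"
    and nonneg: "\<And>n x. 0 \<le> g n x"
    and finite: "(\<Sum>n. \<integral>\<^sup>+x. ennreal (g n x) \<partial>M) \<noteq> \<infinity>"
  shows "AE x in M. (\<lambda>n. g n x) \<longlonglongrightarrow> 0"
proof -
  have "(\<integral>\<^sup>+x. (\<Sum>n. ennreal (g n x)) \<partial>M) \<noteq> \<infinity>"
    using finite by (subst nn_integral_suminf) auto
  then have "AE x in M. (\<Sum>n. ennreal (g n x)) \<noteq> \<infinity>"
    by (intro nn_integral_PInf_AE) auto
  then show ?thesis
  proof eventually_elim
    case (elim x)
    then have "summable (\<lambda>n. g n x)"
      using nonneg by (intro summable_suminf_not_top) auto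
    then show ?case
      by (rule summable_LIMSEQ_zero)
  qed
qed

text \<open>The known moment formula for the density is carried over to the random variable. The
  even power makes the integrand nonnegative, so the Bochner integral becomes the
  \<open>ennreal\<close> integral that the summation argument uses.\<close>

lemma (in prob_space) nn_integral_normal_moment_even:
  assumes "0 < s" and X: "distributed M lborel X (normal_density m s)"
  shows "(\<integral>\<^sup>+x. ennreal ((X x - m) ^ (2 * k)) \<partial>M)
    = ennreal (fact (2 * k) / ((2 / s\<^sup>2) ^ k * fact k))"
proof -
  have "(\<integral>\<^sup>+x. ennreal ((X x - m) ^ (2 * k)) \<partial>M)
      = (\<integral>\<^sup>+x. ennreal (normal_density m s x) * ennreal ((x - m) ^ (2 * k)) \<partial>lborel)"
    by (rule distributed_nn_integral[OF X, symmetric]) simp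
  also have "\<dots> = (\<integral>\<^sup>+x. ennreal (normal_density m s x * (x - m) ^ (2 * k)) \<partial>lborel)"
    by (simp add: ennreal_mult')
  also have "\<dots> = ennreal (fact (2 * k) / ((2 / s\<^sup>2) ^ k * fact k))"
    using normal_moment_even[OF \<open>0 < s\<close>, of m k]
    by (subst nn_integral_eq_integral) (auto simp: has_bochner_integral_iff)
  finally show ?thesis .
qed

lemma (in prob_space) normal_average:
  assumes "0 < s" "finite I" "I \<noteq> {}" and indep: "indep_vars (\<lambda>_. borel) X I"
    and normal: "\<And>i. i \<in> I \<Longrightarrow> distributed M lborel (X i) (normal_density m s)"
  shows "distributed M lborel (\<lambda>x. (\<Sum>i\<in>I. X i x) / card I) (normal_density m (s / sqrt (card I)))"
proof -
  have pos: "0 < real (card I)"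
    using assms by (simp add: card_gt_0_iff)
  have "distributed M lborel (\<lambda>x. \<Sum>i\<in>I. X i x)
      (normal_density (\<Sum>i\<in>I. m) (sqrt (\<Sum>i\<in>I. s\<^sup>2)))"
    using assms by (intro sum_indep_normal) auto
  \<comment> \<open>The sum has standard deviation s * sqrt (card I). It is rescaled by the affine
    rule for normal laws, with translation 0 and factor 1 / card I.\<close>
  then have "distributed M lborel (\<lambda>x. 0 + 1 / card I * (\<Sum>i\<in>I. X i x))
      (normal_density (0 + 1 / card I * (\<Sum>i\<in>I. m)) (\<bar>1 / card I\<bar> * sqrt (\<Sum>i\<in>I. s\<^sup>2)))"
    using \<open>0 < s\<close> pos by (intro normal_density_affine) auto
  moreover have "1 / card I * (\<Sum>i\<in>I. m) = m"
    using pos by simp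
  moreover have "\<bar>1 / card I\<bar> * sqrt (\<Sum>i\<in>I. s\<^sup>2) = s / sqrt (card I)"
    using pos \<open>0 < s\<close> by (simp add: real_sqrt_mult real_div_sqrt field_simps)
  ultimately show ?thesis
    by simp
qed

text \<open>Fourth moments are used because the second moments of the deviations are s^2 / n, whose
  sum diverges.\<close>

theorem (in prob_space) strong_law_normal:
  fixes X :: "nat \<Rightarrow> 'a \<Rightarrow> real"
  assumes "0 < s" and indep: "indep_vars (\<lambda>_. borel) X {1..}"
    and normal: "\<And>k. k \<ge> 1 \<Longrightarrow> distributed M lborel (X k) (normal_density m s)"
  shows "AE x in M. (\<lambda>n. (\<Sum>k=1..n. X k x) / n) \<longlonglongrightarrow> m"
proof -
  \<comment> \<open>The shift to \<open>Suc n\<close> excludes the empty average, which has no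
    normal density.\<close>
  define A where "A n x = (\<Sum>k=1..Suc n. X k x) / Suc n" for n x
  have dist: "distributed M lborel (A n) (normal_density m (s / sqrt (Suc n)))" for n
  proof -
    have "distributed M lborel (\<lambda>x. (\<Sum>k\<in>{1..Suc n}. X k x) / card {1..Suc n})
        (normal_density m (s / sqrt (card {1..Suc n})))"
      by (rule normal_average) (use assms in \<open>auto intro: indep_vars_subset\<close>)
    then show ?thesis
      by (simp add: A_def[abs_def])
  qed
  have [measurable]: "A n \<in> borel_measurable M" for n
    using distributed_measurable[OF dist] by simp
  \<comment> \<open>The even moment with k = 2: the factor 3 is 4! / (2^2 * 2!), and the standard
    deviation s / sqrt (Suc n) enters to the fourth power.\<close>
  have moment: "(\<integral>\<^sup>+x. ennreal ((A n x - m) ^ 4) \<partial>M) = ennreal (3 * s ^ 4 * inverse (real (Suc n) ^ 2))"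
    for n
    using nn_integral_normal_moment_even[OF _ dist, of n 2] \<open>0 < s\<close>
    by (simp add: fact_numeral power_divide field_simps power_mult[symmetric] del: of_nat_Suc)
  have "summable (\<lambda>n. inverse (real (Suc n) ^ 2))"
    using inverse_power_summable[of 2, where ?'a = real] by (subst summable_Suc_iff) simp
  then have "summable (\<lambda>n. 3 * s ^ 4 * inverse (real (Suc n) ^ 2))"
    by (rule summable_mult)
  then have "(\<Sum>n. ennreal (3 * s ^ 4 * inverse (real (Suc n) ^ 2))) \<noteq> \<infinity>"
    unfolding infinity_ennreal_def by (rule ennreal_suminf_neq_top) simp
  then have "AE x in M. (\<lambda>n. (A n x - m) ^ 4) \<longlonglongrightarrow> 0"
    by (intro AE_tendsto_zero_if_nn_integral_suminf_finite) (simp_all only: moment, auto)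
  then show ?thesis
  proof eventually_elim
    case (elim x)
    then have "(\<lambda>n. A n x) \<longlonglongrightarrow> m"
      by (simp add: LIM_zero_iff)
    then show ?case
      unfolding A_def by (rule LIMSEQ_imp_Suc)
  qed
qed

text \<open>Independence means that the joint law is the product of the marginal laws. The joint law
  of the coordinates is \<open>PiM I M\<close> itself, and its marginals are the factors.\<close>

lemma indep_vars_PiM_projections:
  assumes M: "\<And>i. i \<in> I \<Longrightarrow> prob_space (M i)" and "I \<noteq> {}"
  shows "prob_space.indep_vars (PiM I M) M (\<lambda>i \<omega>. \<omega> i) I"
proof -
  interpret prob_space "PiM I M"
    by (rule prob_space_PiM) (rule M)
  \<comment> \<open>Points of the product space are extensional, so restricting them to
    \<open>I\<close> changes nothing.\<close>
  have "distr (PiM I M) (PiM I M) (\<lambda>\<omega>. \<lambda>i\<in>I. \<omega> i) = distr (PiM I M) (PiM I M) (\<lambda>\<omega>. \<omega>)"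
    by (rule distr_cong) (auto simp: space_PiM)
  also have "\<dots> = PiM I (\<lambda>i. distr (PiM I M) (M i) (\<lambda>\<omega>. \<omega> i))"
    by (simp add: distr_PiM_component M cong: PiM_cong)
  finally show ?thesis
    using \<open>I \<noteq> {}\<close> by (subst indep_vars_iff_distr_eq_PiM') auto
qed

lemma real_distribution_gaussian_measure:
  assumes "0 < v"
  shows "real_distribution (gaussian_measure m v)"
  using prob_space_normal_density[of "sqrt v" m] assms
  by (simp add: gaussian_measure_def real_distribution_def real_distribution_axioms_def)

lemma AE_average_tendsto_gaussian_mean:
  assumes "0 < v"
  shows "AE z in infinite_power (gaussian_measure m v). (\<lambda>n. (\<Sum>k=1..n. z k) / n) \<longlonglongrightarrow> m"
proof -
  let ?G = "gaussian_measure m v"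
  interpret G: real_distribution ?G
    using assms by (rule real_distribution_gaussian_measure)
  interpret P: prob_space "infinite_power ?G"
    unfolding infinite_power_def by (rule prob_space_PiM) unfold_locales
  have proj: "(\<lambda>z. z k) \<in> measurable (infinite_power ?G) ?G" if "k \<ge> 1" for k
    using that unfolding infinite_power_def by simp
  have "P.indep_vars (\<lambda>_. ?G) (\<lambda>k z. z k) {1..}"
    unfolding infinite_power_def by (rule indep_vars_PiM_projections) (auto intro: G.prob_space_axioms)
  \<comment> \<open>Each coordinate is composed with the identity, which is measurable because
    \<open>?G\<close> carries the Borel sigma-algebra.\<close>
  then have "P.indep_vars (\<lambda>_. borel) (\<lambda>k z. z k) {1..}"
    by (rule P.indep_vars_compose2) simp
  moreover have "distributed (infinite_power ?G) lborel (\<lambda>z. z k) (normal_density m (sqrt v))"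
    if "k \<ge> 1" for k
  proof -
    \<comment> \<open>A push-forward depends on its target only through the sigma-algebra, so
      \<open>lborel\<close> may be exchanged for \<open>?G\<close>.\<close>
    have "distr (infinite_power ?G) lborel (\<lambda>z. z k) = distr (infinite_power ?G) ?G (\<lambda>z. z k)"
      by (rule distr_cong) auto
    also have "\<dots> = ?G"
      using that unfolding infinite_power_def
      by (intro distr_PiM_component) (auto intro: G.prob_space_axioms)
    finally show ?thesis
      using proj[OF that] by (auto simp: distributed_def gaussian_measure_def)
  qed
  ultimately show ?thesis
    using assms by (intro P.strong_law_normal[where s = "sqrt v"]) auto
qed

lemma ou_variance_pos:
  assumes "t > 0" "\<theta> > 0" "\<sigma> > 0"
  shows "ou_variance t \<theta> \<sigma> > 0"
  using assms by (simp add: ou_variance_def)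

lemma ou_estimator_restrict:
  "ou_estimator t x\<^sub>0 \<theta> n (restrict z {1..n}) = ou_estimator t x\<^sub>0 \<theta> n z"
  by (simp add: ou_estimator_def)

lemma ou_estimator_tendsto:
  assumes "t > 0" "\<theta> > 0" and lim: "(\<lambda>n. (\<Sum>k=1..n. z k) / n) \<longlonglongrightarrow> ou_mean t x\<^sub>0 \<theta> \<mu>"
  shows "(\<lambda>n. ou_estimator t x\<^sub>0 \<theta> n z) \<longlonglongrightarrow> \<mu>"
proof -
  have nz: "1 - exp (- \<theta> * t) \<noteq> 0"
    using assms by simp
  have "(\<lambda>n. ou_estimator t x\<^sub>0 \<theta> n z)
      \<longlonglongrightarrow> (ou_mean t x\<^sub>0 \<theta> \<mu> - x\<^sub>0 * exp (- \<theta> * t)) / (1 - exp (- \<theta> * t))"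
    unfolding ou_estimator_def using nz by (intro tendsto_intros lim)
  also have "(ou_mean t x\<^sub>0 \<theta> \<mu> - x\<^sub>0 * exp (- \<theta> * t)) / (1 - exp (- \<theta> * t)) = \<mu>"
    using nz by (simp add: ou_mean_def)
  finally show ?thesis .
qed

text \<open>The index set and the factors are left general to cover both the finite space of
  n-tuples and the infinite product of the laws.\<close>

lemma borel_measurable_ou_estimator:
  assumes "{1..n} \<subseteq> I" and "\<And>i. i \<in> I \<Longrightarrow> sets (M i) = sets borel"
  shows "ou_estimator t x\<^sub>0 \<theta> n \<in> borel_measurable (PiM I M)"
proof -
  have "(\<lambda>z. z k) \<in> borel_measurable (PiM I M)" if "k \<in> {1..n}" for k
    using assms that measurable_component_singleton[of k I M]
    by (metis measurable_cong_sets subsetD)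
  then show ?thesis
    unfolding ou_estimator_def[abs_def]
    by (intro borel_measurable_divide borel_measurable_diff borel_measurable_sum borel_measurable_const)
qed

theorem lemma3p2p1:
  fixes t x\<^sub>0 \<theta> \<sigma> :: real
  assumes "t > 0" and "\<theta> > 0" and "\<sigma> > 0"
  shows "(\<forall>\<mu>::real. measure (infinite_power (ou_law t x\<^sub>0 \<theta> \<sigma> \<mu>))
            {z \<in> space (infinite_power (ou_law t x\<^sub>0 \<theta> \<sigma> \<mu>)).
              (\<lambda>n. ou_estimator t x\<^sub>0 \<theta> n (restrict z {1..n})) \<longlonglongrightarrow> \<mu>} = 1) \<and>
         consistent_estimator UNIV (ou_law t x\<^sub>0 \<theta> \<sigma>) (ou_estimator t x\<^sub>0 \<theta>)"
proof -
  have dist: "real_distribution (ou_law t x\<^sub>0 \<theta> \<sigma> \<mu>)" for \<mu>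
    unfolding ou_law_def using assms by (intro real_distribution_gaussian_measure ou_variance_pos)
  have "measure (infinite_power (ou_law t x\<^sub>0 \<theta> \<sigma> \<mu>))
      {z \<in> space (infinite_power (ou_law t x\<^sub>0 \<theta> \<sigma> \<mu>)).
        (\<lambda>n. ou_estimator t x\<^sub>0 \<theta> n (restrict z {1..n})) \<longlonglongrightarrow> \<mu>} = 1" for \<mu>
  proof -
    let ?P = "infinite_power (ou_law t x\<^sub>0 \<theta> \<sigma> \<mu>)"
    interpret L: real_distribution "ou_law t x\<^sub>0 \<theta> \<sigma> \<mu>"
      by (rule dist)
    interpret P: prob_space ?P
      unfolding infinite_power_def by (rule prob_space_PiM) unfold_locales
    have [measurable]: "ou_estimator t x\<^sub>0 \<theta> n \<in> borel_measurable ?P" for n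
      unfolding infinite_power_def by (rule borel_measurable_ou_estimator) auto
    have "AE z in ?P. (\<lambda>n. (\<Sum>k=1..n. z k) / n) \<longlonglongrightarrow> ou_mean t x\<^sub>0 \<theta> \<mu>"
      unfolding ou_law_def using assms by (intro AE_average_tendsto_gaussian_mean ou_variance_pos)
    then have "AE z in ?P. (\<lambda>n. ou_estimator t x\<^sub>0 \<theta> n z) \<longlonglongrightarrow> \<mu>"
      by eventually_elim (use assms in \<open>auto intro: ou_estimator_tendsto\<close>)
    then show ?thesis
      by (simp only: ou_estimator_restrict) (subst P.prob_Collect_eq_1, measurable)
  qed
  moreover have "ou_estimator t x\<^sub>0 \<theta> n \<in> borel_measurable (PiM {1..n} (\<lambda>_. borel))" for n
    by (rule borel_measurable_ou_estimator) auto
  ultimately show ?thesis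
    using dist by (simp add: consistent_estimator_def)
qed

end
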